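(* Let $A,C\in\mathbb{R}^{n\times n}$, $b\in\mathbb{R}^{n\times m}$, $G=G^\top\in\mathbb{R}^{n\times n}$, with $\rho(A)<1$. If the system $$x_{t+1}=Ax_t+bu_t+Cx_t\xi_{t+1}\quad(t=0,1,2,\dots),\qquad x_0=a,$$ is stable in the mean-square sense for $u_t\equiv 0$, then there exist symmetric matrices $H,\Theta\in\mathbb{C}^{n\times n}$ satisfying $$A^\top HA-H+\Theta=0,\qquad \Theta-C^\top HC-G=0.$$
   Context: $(\Omega,\mathscr{F},\mathbf{P})$ is a standard probability space with a non-decreasing flow of $\sigma$-algebras $\mathscr{F}_t\subset\mathscr{F}$. The scalar real process $\xi_t$ is discrete-time white noise adapted to $\mathscr{F}_t$ with $\mathbf{E}\,\xi_t=0$, $\mathbf{Var}(\xi_t)=1$, where $\xi_{t+1}$ is independent of $\mathscr{F}_t$. The random vector $a$ with values in $\mathbb{R}^n$ is $\mathscr{F}_0$-measurable, independent of $\{\xi_t\}_{t\ge 0}$, with $\mathbf{E}|a|^2<\infty$ and $\mathbf{E}|aa^\top|^2<\infty$ (Euclidean norm for vectors, Frobenius norm for matrices). Here $\rho(\cdot)$ is the spectral radius. Mean-square stability for $u_t\equiv 0$ means that the solution of $x_{t+1}=Ax_t+Cx_t\xi_{t+1}$ satisfies $\mathbf{E}|x_t|^2\to 0$ for every $\mathscr{F}_0$-measurable random initial vector $x_0$ with values in $\mathbb{R}^n$ that is independent of $\{\xi_t\}_{t\ge 0}$ and satisfies $\mathbf{E}|x_0|^2<\infty$ and $\mathbf{E}|x_0x_0^\top|^2<\infty$;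 equivalently, $\rho(A\otimes A+C\otimes C)<1$, where $\otimes$ is the Kronecker product. *)

theory Defs
  imports "HOL-Probability.Probability"
begin

definition cmat :: "real^'n^'m \<Rightarrow> complex^'n^'m"
  where "cmat = map_matrix complex_of_real"

definition cspectrum :: "complex^'n^'n \<Rightarrow> complex set"
  where "cspectrum A = {k. \<exists>v. v \<noteq> 0 \<and> A *v v = k *s v}"

text \<open>The complex spectrum of a square matrix is finite and nonempty (index types are nonempty),
  so \<^const>\<open>Max\<close> is meaningful here. For a real matrix \<open>A\<close> the spectral radius is
  \<open>matrix_spectral_radius (cmat A)\<close>, i.e. non-real eigenvalues are counted.\<close>

definition matrix_spectral_radius :: "complex^'n^'n \<Rightarrow> real"
  where "matrix_spectral_radius A = Max (cmod ` cspectrum A)"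

definition outer_product :: "real^'n \<Rightarrow> real^'n^'n"
  where "outer_product x = (\<chi> i j. x $ i * x $ j)"

locale discrete_white_noise =
  prob_space M + filtration "space M" F
  for M :: "'w measure" and F :: "nat \<Rightarrow> 'w measure" +
  fixes \<xi> :: "nat \<Rightarrow> 'w \<Rightarrow> real"
  assumes subalgebra: "\<And>t. subalgebra M (F t)"
    and adapted: "\<And>t. \<xi> t \<in> borel_measurable (F t)"
    and square_integrable: "\<And>t. integrable M (\<lambda>\<omega>. (\<xi> t \<omega>)\<^sup>2)"
    and mean_zero: "\<And>t. expectation (\<xi> t) = 0"
    and variance_one: "\<And>t. variance (\<xi> t) = 1"
    and indep_past: "\<And>t. indep_set (sets (vimage_algebra (space M) (\<xi> (Suc t)) borel)) (sets (F t))"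
begin

text \<open>Independence of the whole process \<open>\<xi>\<close> is expressed through the \<open>\<sigma>\<close>-algebras generated by
  \<open>x\<^sub>0\<close> and by the map \<open>\<omega> \<mapsto> (\<xi> t \<omega>)\<^sub>t\<close>; \<^const>\<open>indep_var\<close> is not available since the two variables
  have different value types. The norm on \<^typ>\<open>real^'n^'n\<close> is the Frobenius norm.\<close>

definition admissible_initial :: "('w \<Rightarrow> real^'n) \<Rightarrow> bool"
  where "admissible_initial x0 \<longleftrightarrow>
    x0 \<in> borel_measurable (F 0) \<and>
    indep_set (sets (vimage_algebra (space M) x0 borel))
      (sets (vimage_algebra (space M) (\<lambda>\<omega> t. \<xi> t \<omega>) (Pi\<^sub>M UNIV (\<lambda>_. borel)))) \<and>
    integrable M (\<lambda>\<omega>. (norm (x0 \<omega>))\<^sup>2) \<and>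
    integrable M (\<lambda>\<omega>. (norm (outer_product (x0 \<omega>)))\<^sup>2)"

primrec state ::
  "real^'n^'n \<Rightarrow> real^'m^'n \<Rightarrow> real^'n^'n \<Rightarrow> (nat \<Rightarrow> 'w \<Rightarrow> real^'m) \<Rightarrow> ('w \<Rightarrow> real^'n) \<Rightarrow>
    nat \<Rightarrow> 'w \<Rightarrow> real^'n"
  where
    "state A b C u x0 0 = x0"
  | "state A b C u x0 (Suc t) = (\<lambda>\<omega>.
      A *v state A b C u x0 t \<omega> + b *v u t \<omega> + \<xi> (Suc t) \<omega> *\<^sub>R (C *v state A b C u x0 t \<omega>))"

text \<open>Second moments are taken as nonnegative integrals, so that an infinite moment would count
  as \<open>\<infinity>\<close>.\<close>

definition mean_square_stable :: "real^'n^'n \<Rightarrow> real^'m^'n \<Rightarrow> real^'n^'n \<Rightarrow> bool"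
  where "mean_square_stable A b C \<longleftrightarrow>
    (\<forall>x0. admissible_initial x0 \<longrightarrow>
      (\<lambda>t. \<integral>\<^sup>+ \<omega>. ennreal ((norm (state A b C (\<lambda>_ _. 0) x0 t \<omega>))\<^sup>2) \<partial>M) \<longlonglongrightarrow> 0)"

end

end

theory Submission
  imports Defs
begin

text \<open>Write \<open>L\<^sup>*(H) = A\<^sup>T H A + C\<^sup>T H C\<close>; the claim is that \<open>H - L\<^sup>*(H) = G\<close> has a symmetric
  solution. By finite dimension it suffices that \<open>id - L\<^sup>*\<close> is injective on symmetric matrices.
  Along a trajectory with \<open>u = 0\<close>, independence of \<open>\<xi>\<^sub>t\<^sub>+\<^sub>1\<close> from the past gives
  \<open>E x\<^sub>t\<^sub>+\<^sub>1\<^sup>T H x\<^sub>t\<^sub>+\<^sub>1 = E x\<^sub>t\<^sup>T L\<^sup>*(H) x\<^sub>t\<close>. If \<open>L\<^sup>*(H) = H\<close>, this quantity is constant in \<open>t\<close>, while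
  it is bounded by a multiple of \<open>E |x\<^sub>t|\<^sup>2 \<longlonglongrightarrow> 0\<close>; starting from a deterministic \<open>x\<^sub>0 = v\<close> one gets
  \<open>v\<^sup>T H v = 0\<close> for every \<open>v\<close>, that is \<open>H = 0\<close>.\<close>

section \<open>Quadratic forms and linear maps on a subspace\<close>

lemma symmetric_matrix_eq_0:
  fixes H :: "real^'n^'n"
  assumes "transpose H = H" and "\<And>v. v \<bullet> (H *v v) = 0"
  shows "H = 0"
proof -
  \<comment> \<open>Polarization: expanding the form at \<open>u + w\<close> leaves, by symmetry of
    \<open>H\<close>, twice the bilinear term.\<close>
  have "u \<bullet> (H *v w) = 0" for u w
  proof -
    have "w \<bullet> (H *v u) = u \<bullet> (H *v w)"
      using assms(1) dot_lmul_matrix[of w H u]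
      by (metis inner_commute vector_transpose_matrix)
    then show ?thesis
      using assms(2)[of "u + w"] assms(2)[of u] assms(2)[of w]
      by (simp add: matrix_vector_right_distrib inner_add_left inner_add_right)
  qed
  then have "H *v w = 0 *v w" for w
    by (metis inner_eq_zero_iff matrix_vector_mult_0)
  then show ?thesis
    by (metis matrix_eq)
qed

lemma inner_matrix_vector_mult_congruence:
  fixes B B' H :: "real^'n^'n"
  shows "(B *v x) \<bullet> (H *v (B' *v y)) = x \<bullet> ((transpose B ** H ** B') *v y)"
  by (simp add: matrix_vector_mul_assoc[symmetric] dot_lmul_matrix[symmetric]
      del: transpose_matrix_vector)

lemma abs_quadratic_form_le:
  fixes H :: "real^'n^'n"
  shows "\<bar>x \<bullet> (H *v x)\<bar> \<le> onorm ((*v) H) * (norm x)\<^sup>2"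
proof -
  have "\<bar>x \<bullet> (H *v x)\<bar> \<le> norm x * norm (H *v x)"
    by (rule Cauchy_Schwarz_ineq2)
  also have "\<dots> \<le> norm x * (onorm ((*v) H) * norm x)"
    by (intro mult_left_mono onorm) auto
  finally show ?thesis
    by (simp add: power2_eq_square mult_ac)
qed

text \<open>Rank-nullity on \<open>S\<close>: a trivial kernel preserves the dimension, and a
  subspace of \<open>S\<close> of the same dimension is all of \<open>S\<close>. This turns
  uniqueness for the matrix equation into existence.\<close>

lemma linear_inj_on_subspace_imp_surj_on:
  fixes f :: "'a::euclidean_space \<Rightarrow> 'a"
  assumes "linear f" "subspace S" "f ` S \<subseteq> S" and "\<And>x. x \<in> S \<Longrightarrow> f x = 0 \<Longrightarrow> x = 0"
  shows "f ` S = S"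
proof (rule subspace_dim_equal)
  have "inj_on f (span S)"
    using assms by (simp add: linear_inj_on_iff_eq_0 span_eq_iff[THEN iffD2])
  then show "dim S \<le> dim (f ` S)"
    using dim_image_eq[OF assms(1)] by simp
qed (use assms linear_subspace_image in auto)

section \<open>Real matrices embedded into complex ones\<close>

lemma cmat_transpose: "transpose (cmat A) = cmat (transpose A)"
  by (simp add: cmat_def map_matrix_def transpose_def vec_eq_iff)

lemma cmat_mult: "cmat A ** cmat B = cmat (A ** B)"
  by (simp add: cmat_def map_matrix_def matrix_matrix_mult_def vec_eq_iff)

lemma cmat_add: "cmat A + cmat B = cmat (A + B)"
  by (simp add: cmat_def map_matrix_def vec_eq_iff)

lemma cmat_diff: "cmat A - cmat B = cmat (A - B)"
  by (simp add: cmat_def map_matrix_def vec_eq_iff)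

lemma cmat_0: "cmat 0 = 0"
  by (simp add: cmat_def map_matrix_def vec_eq_iff)

lemma borel_measurable_matrix_vector_mult [measurable (raw)]:
  fixes P :: "real^'n^'m"
  assumes "f \<in> borel_measurable M"
  shows "(\<lambda>\<omega>. P *v f \<omega>) \<in> borel_measurable M"
  using assms by (rule measurable_compose[OF _ borel_measurable_continuous_onI[OF
          linear_continuous_on[OF matrix_vector_mul_bounded_linear]]])

section \<open>Deterministic initial states and independence of the noise from the past\<close>

context discrete_white_noise
begin

lemma measurable_past: "f \<in> measurable (F t) N \<Longrightarrow> f \<in> measurable M N"
  using measurable_from_subalg[OF subalgebra] .

lemma measurable_noise: "\<xi> t \<in> borel_measurable M"
  using adapted measurable_past by blast

text \<open>A constant generates only the trivial events, empty set and whole space, which are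
  independent of every event. Hence stability may be tested from any deterministic starting
  vector.\<close>

lemma admissible_initial_const: "admissible_initial (\<lambda>_. v)"
proof -
  let ?N = "vimage_algebra (space M) (\<lambda>\<omega> t. \<xi> t \<omega>) (Pi\<^sub>M UNIV (\<lambda>_. borel))"
  have "(\<lambda>\<omega> t. \<xi> t \<omega>) \<in> measurable M (Pi\<^sub>M UNIV (\<lambda>_. borel))"
    using measurable_noise by (intro measurable_PiM_single') auto
  then have N: "sets ?N \<subseteq> events"
    by (auto simp: sets_vimage_algebra2 measurable_def)
  have c: "E = {} \<or> E = space M"
    if "E \<in> sets (vimage_algebra (space M) (\<lambda>_. v) borel)" for E
    using that by (auto simp: sets_vimage_algebra2 split: if_splits)
  have "indep_set (sets (vimage_algebra (space M) (\<lambda>_. v) borel)) (sets ?N)"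
  proof (rule indep_setI)
    fix E E' assume E: "E \<in> sets (vimage_algebra (space M) (\<lambda>_. v) borel)" "E' \<in> sets ?N"
    then have "E' \<in> events" using N by blast
    then show "prob (E \<inter> E') = prob E * prob E'"
      using c[OF E(1)] by (auto simp: prob_space)
  qed (use N c in blast)+
  then show ?thesis
    by (simp add: admissible_initial_def)
qed

text \<open>The first factor generates a sub-\<sigma>-algebra of the one generated by
  \<open>\<xi> (Suc t)\<close>, the second a sub-\<sigma>-algebra of \<open>F t\<close>;
  independence passes to both, so expectations factor. It is applied below with \<open>f\<close> the
  identity and the square.\<close>

lemma
  fixes Y :: "'w \<Rightarrow> real" and f :: "real \<Rightarrow> real"
  assumes Y: "Y \<in> borel_measurable (F t)" "integrable M Y"
    and f: "f \<in> borel_measurable borel" "integrable M (\<lambda>\<omega>. f (\<xi> (Suc t) \<omega>))"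
  shows integrable_noise_mult: "integrable M (\<lambda>\<omega>. f (\<xi> (Suc t) \<omega>) * Y \<omega>)"
    and expectation_noise_mult:
      "expectation (\<lambda>\<omega>. f (\<xi> (Suc t) \<omega>) * Y \<omega>) = expectation (\<lambda>\<omega>. f (\<xi> (Suc t) \<omega>)) * expectation Y"
proof -
  have sp: "space (F t) = space M"
    using subalgebra[of t] by (simp add: subalgebra_def)
  have "indep_var borel (\<lambda>\<omega>. f (\<xi> (Suc t) \<omega>)) borel Y"
    unfolding indep_var_eq
  proof (intro conjI)
    show "random_variable borel (\<lambda>\<omega>. f (\<xi> (Suc t) \<omega>))" "random_variable borel Y"
      using f measurable_noise[of "Suc t"] measurable_past[OF Y(1)] by measurable
    let ?S = "sigma_sets (space M) {(\<lambda>\<omega>. f (\<xi> (Suc t) \<omega>)) -` A \<inter> space M |A. A \<in> sets borel}"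
    let ?T = "sigma_sets (space M) {Y -` A \<inter> space M |A. A \<in> sets borel}"
    let ?N = "vimage_algebra (space M) (\<xi> (Suc t)) borel"
    have "(\<lambda>\<omega>. f (\<xi> (Suc t) \<omega>)) -` B \<inter> space M \<in> sets ?N" if "B \<in> sets borel" for B
      using in_vimage_algebra[OF measurable_sets_borel[OF f(1) that], of "\<xi> (Suc t)" "space M"]
      by (simp add: vimage_def)
    then have S: "?S \<subseteq> sets ?N"
      using sets.sigma_sets_subset[of "{(\<lambda>\<omega>. f (\<xi> (Suc t) \<omega>)) -` A \<inter> space M |A. A \<in> sets borel}" ?N]
      by (auto simp only: space_vimage_algebra)
    have T: "?T \<subseteq> sets (F t)"
      using measurable_sets[OF Y(1)] sp
        sets.sigma_sets_subset[of "{Y -` A \<inter> space M |A. A \<in> sets borel}" "F t"]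
      by (auto simp only:)
    show "indep_set ?S ?T"
      unfolding indep_set_def
      by (rule indep_sets_mono_sets[OF indep_past[of t, unfolded indep_set_def]])
        (use S T in \<open>simp split: bool.split\<close>)
  qed
  from indep_var_integrable[OF this f(2) Y(2)] indep_var_lebesgue_integral[OF this f(2) Y(2)]
  show "integrable M (\<lambda>\<omega>. f (\<xi> (Suc t) \<omega>) * Y \<omega>)"
    and "expectation (\<lambda>\<omega>. f (\<xi> (Suc t) \<omega>) * Y \<omega>)
      = expectation (\<lambda>\<omega>. f (\<xi> (Suc t) \<omega>)) * expectation Y"
    by auto
qed

section \<open>Evolution of second moments in one time step\<close>

lemma expectation_noise_square: "expectation (\<lambda>\<omega>. (\<xi> t \<omega>)\<^sup>2) = 1"
  using variance_one[of t] mean_zero[of t] by simp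

lemma integrable_noise: "integrable M (\<xi> t)"
  using square_integrable_imp_integrable[OF measurable_noise square_integrable] .

lemma integrable_quadratic_form:
  fixes x :: "'w \<Rightarrow> real^'n"
  assumes "x \<in> borel_measurable M" "integrable M (\<lambda>\<omega>. (norm (x \<omega>))\<^sup>2)"
  shows "integrable M (\<lambda>\<omega>. x \<omega> \<bullet> (P *v x \<omega>))"
proof (rule Bochner_Integration.integrable_bound)
  show "integrable M (\<lambda>\<omega>. onorm ((*v) P) * (norm (x \<omega>))\<^sup>2)"
    using assms(2) by simp
  show "AE \<omega> in M. norm (x \<omega> \<bullet> (P *v x \<omega>)) \<le> norm (onorm ((*v) P) * (norm (x \<omega>))\<^sup>2)"
    unfolding real_norm_def
    by (intro AE_I2 order_trans[OF abs_quadratic_form_le abs_ge_self])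
qed (use assms(1) in measurable)

text \<open>The form at the new state is a polynomial of degree two in \<open>\<xi> (Suc t)\<close>
  whose coefficients are quadratic forms in the old state, hence \<open>F t\<close>-measurable. Mean
  zero removes the linear term and second moment one gives the quadratic term weight one.\<close>

lemma quadratic_form_step:
  fixes A C H :: "real^'n^'n" and x :: "'w \<Rightarrow> real^'n"
  assumes meas: "x \<in> borel_measurable (F t)" and int: "integrable M (\<lambda>\<omega>. (norm (x \<omega>))\<^sup>2)"
  defines "y \<equiv> \<lambda>\<omega>. A *v x \<omega> + \<xi> (Suc t) \<omega> *\<^sub>R (C *v x \<omega>)"
  shows "integrable M (\<lambda>\<omega>. y \<omega> \<bullet> (H *v y \<omega>))"
    and "expectation (\<lambda>\<omega>. y \<omega> \<bullet> (H *v y \<omega>)) =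
      expectation (\<lambda>\<omega>. x \<omega> \<bullet> ((transpose A ** H ** A + transpose C ** H ** C) *v x \<omega>))"
proof -
  define q where "q P \<omega> = x \<omega> \<bullet> (P *v x \<omega>)" for P \<omega>
  \<comment> \<open>The two cross terms together form the coefficient of the first power of the
    noise.\<close>
  define D where "D = transpose A ** H ** C + transpose C ** H ** A"
  let ?A = "transpose A ** H ** A" and ?C = "transpose C ** H ** C"
  have eq: "y \<omega> \<bullet> (H *v y \<omega>) = q ?A \<omega> + \<xi> (Suc t) \<omega> * q D \<omega> + (\<xi> (Suc t) \<omega>)\<^sup>2 * q ?C \<omega>" for \<omega>
    by (simp add: y_def q_def D_def inner_matrix_vector_mult_congruence[symmetric]
        matrix_vector_right_distrib matrix_vector_mult_add_rdistrib matrix_vector_mult_scaleR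
        inner_add_left inner_add_right
        power2_eq_square algebra_simps)
  have q_meas: "q P \<in> borel_measurable (F t)" for P
    unfolding q_def using meas by measurable
  have q_int: "integrable M (q P)" for P
    unfolding q_def using integrable_quadratic_form[OF measurable_past[OF meas] int] .
  have lin: "integrable M (\<lambda>\<omega>. \<xi> (Suc t) \<omega> * q D \<omega>)"
      "expectation (\<lambda>\<omega>. \<xi> (Suc t) \<omega> * q D \<omega>) = 0"
    using integrable_noise_mult[OF q_meas q_int, of "\<lambda>z. z"]
      expectation_noise_mult[OF q_meas q_int, of "\<lambda>z. z"] integrable_noise mean_zero by auto
  have sq: "integrable M (\<lambda>\<omega>. (\<xi> (Suc t) \<omega>)\<^sup>2 * q ?C \<omega>)"
      "expectation (\<lambda>\<omega>. (\<xi> (Suc t) \<omega>)\<^sup>2 * q ?C \<omega>) = expectation (q ?C)"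
    using integrable_noise_mult[OF q_meas q_int, of "\<lambda>z. z\<^sup>2"]
      expectation_noise_mult[OF q_meas q_int, of "\<lambda>z. z\<^sup>2"]
      square_integrable expectation_noise_square by auto
  show "integrable M (\<lambda>\<omega>. y \<omega> \<bullet> (H *v y \<omega>))"
    unfolding eq using q_int lin(1) sq(1) by simp
  have "q (?A + ?C) \<omega> = q ?A \<omega> + q ?C \<omega>" for \<omega>
    by (simp add: q_def matrix_vector_mult_add_rdistrib inner_add_right)
  then have "expectation (q (?A + ?C)) = expectation (q ?A) + expectation (q ?C)"
    using Bochner_Integration.integral_add[OF q_int q_int] by presburger
  then have "expectation (\<lambda>\<omega>. y \<omega> \<bullet> (H *v y \<omega>)) = expectation (q (?A + ?C))"
    unfolding eq using q_int lin sq by simp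
  then show "expectation (\<lambda>\<omega>. y \<omega> \<bullet> (H *v y \<omega>)) =
      expectation (\<lambda>\<omega>. x \<omega> \<bullet> ((?A + ?C) *v x \<omega>))"
    by (simp add: q_def[abs_def])
qed

lemma state_measurable_and_square_integrable:
  assumes "x0 \<in> borel_measurable (F 0)" "integrable M (\<lambda>\<omega>. (norm (x0 \<omega>))\<^sup>2)"
  shows "state A b C (\<lambda>_ _. 0) x0 t \<in> borel_measurable (F t) \<and>
    integrable M (\<lambda>\<omega>. (norm (state A b C (\<lambda>_ _. 0) x0 t \<omega>))\<^sup>2)"
proof (induction t)
  case 0
  then show ?case using assms by simp
next
  case (Suc t)
  let ?x = "state A b C (\<lambda>_ _. 0) x0"
  have "subalgebra (F (Suc t)) (F t)"
    using space_F sets_F_mono[of t "Suc t"] by (simp add: subalgebra_def)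
  then have [measurable]: "?x t \<in> borel_measurable (F (Suc t))"
    using Suc measurable_from_subalg by blast
  have [measurable]: "\<xi> (Suc t) \<in> borel_measurable (F (Suc t))"
    by (rule adapted)
  have "?x (Suc t) \<in> borel_measurable (F (Suc t))"
    by simp
  \<comment> \<open>With the identity matrix as \<open>H\<close>, the quadratic form is the squared
    norm, so square integrability propagates.\<close>
  moreover have "integrable M (\<lambda>\<omega>. (norm (?x (Suc t) \<omega>))\<^sup>2)"
    using quadratic_form_step(1)[of "?x t" t A C "mat 1"] Suc
    by (simp add: power2_norm_eq_inner)
  ultimately show ?case ..
qed

section \<open>Conserved quadratic forms and mean-square stability\<close>

lemma expectation_quadratic_form_invariant:
  fixes H :: "real^'n^'n"
  assumes "x0 \<in> borel_measurable (F 0)" "integrable M (\<lambda>\<omega>. (norm (x0 \<omega>))\<^sup>2)"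
    and "transpose A ** H ** A + transpose C ** H ** C = H"
  shows "expectation (\<lambda>\<omega>. state A b C (\<lambda>_ _. 0) x0 t \<omega> \<bullet> (H *v state A b C (\<lambda>_ _. 0) x0 t \<omega>)) =
    expectation (\<lambda>\<omega>. x0 \<omega> \<bullet> (H *v x0 \<omega>))"
proof (induction t)
  case (Suc t)
  then show ?case
    using quadratic_form_step(2)[of "state A b C (\<lambda>_ _. 0) x0 t" t A C H] assms(3)
      state_measurable_and_square_integrable[OF assms(1,2), of A b C t]
    by simp
qed simp

lemma stable_invariant_form_eq_0:
  fixes A C H :: "real^'n^'n"
  assumes "mean_square_stable A b C" "transpose H = H"
    and "transpose A ** H ** A + transpose C ** H ** C = H"
  shows "H = 0"
proof (rule symmetric_matrix_eq_0[OF assms(2)])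
  fix v :: "real^'n"
  define x where "x = state A b C (\<lambda>_ _. 0) (\<lambda>_. v)"
  define m where "m t = expectation (\<lambda>\<omega>. (norm (x t \<omega>))\<^sup>2)" for t
  have x: "x t \<in> borel_measurable M" "integrable M (\<lambda>\<omega>. (norm (x t \<omega>))\<^sup>2)" for t
    using state_measurable_and_square_integrable[of "\<lambda>_. v" A b C t] measurable_past
    by (auto simp: x_def)
  have "(\<lambda>t. \<integral>\<^sup>+ \<omega>. ennreal ((norm (x t \<omega>))\<^sup>2) \<partial>M) \<longlonglongrightarrow> 0"
    using assms(1) admissible_initial_const unfolding mean_square_stable_def x_def by blast
  \<comment> \<open>Second moments are finite at every time, so the nonnegative integral equals the
    ordinary expectation.\<close>
  then have "(\<lambda>t. ennreal (m t)) \<longlonglongrightarrow> ennreal 0"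
    using x by (simp add: m_def nn_integral_eq_integral)
  then have "m \<longlonglongrightarrow> 0"
    by (subst (asm) tendsto_ennreal_iff) (auto simp: m_def)
  then have lim: "(\<lambda>t. onorm ((*v) H) * m t) \<longlonglongrightarrow> 0"
    by (rule tendsto_mult_right_zero)
  \<comment> \<open>Invariance carries the deterministic value at time 0 to the expectation at any
    time \<open>t\<close>, where the second moment controls it.\<close>
  have "\<bar>v \<bullet> (H *v v)\<bar> \<le> onorm ((*v) H) * m t" for t
  proof -
    have "v \<bullet> (H *v v) = expectation (\<lambda>\<omega>. x t \<omega> \<bullet> (H *v x t \<omega>))"
      using expectation_quadratic_form_invariant[of "\<lambda>_. v" A H C b t] assms(3)
      by (simp add: x_def prob_space)
    also have "\<bar>\<dots>\<bar> \<le> expectation (\<lambda>\<omega>. \<bar>x t \<omega> \<bullet> (H *v x t \<omega>)\<bar>)"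
      by (rule integral_abs_bound)
    also have "\<dots> \<le> expectation (\<lambda>\<omega>. onorm ((*v) H) * (norm (x t \<omega>))\<^sup>2)"
      using x integrable_quadratic_form[OF x] abs_quadratic_form_le
      by (intro integral_mono) auto
    finally show ?thesis
      by (simp add: m_def)
  qed
  \<comment> \<open>The left side is the same for all \<open>t\<close>, while the bound tends to
    0.\<close>
  then have "\<bar>v \<bullet> (H *v v)\<bar> \<le> 0"
    by (intro LIMSEQ_le_const[OF lim]) auto
  then show "v \<bullet> (H *v v) = 0"
    by simp
qed

section \<open>Solvability of the generalized Lyapunov equation\<close>

lemma stable_lyapunov_equation_solvable:
  fixes A C G :: "real^'n^'n"
  assumes "mean_square_stable A b C" "transpose G = G"
  shows "\<exists>H. transpose H = H \<and> H - (transpose A ** H ** A + transpose C ** H ** C) = G"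
proof -
  \<comment> \<open>The restriction to symmetric matrices matters: a quadratic form does not see the
    skew part of its matrix, so the vanishing argument gives a trivial kernel only on
    \<open>S\<close>.\<close>
  define S where "S = {H :: real^'n^'n. transpose H = H}"
  define f where "f H = H - (transpose A ** H ** A + transpose C ** H ** C)" for H :: "real^'n^'n"
  have tr: "transpose (X + Y) = transpose X + transpose Y"
    "transpose (X - Y) = transpose X - transpose Y" for X Y :: "real^'n^'n"
    by (simp_all add: transpose_def vec_eq_iff)
  have "linear f"
  proof
    show "f (X + Y) = f X + f Y" for X Y
      by (simp add: f_def matrix_add_ldistrib matrix_matrix_mult_def vec_eq_iff
          sum.distrib algebra_simps)
    show "f (r *\<^sub>R X) = r *\<^sub>R f X" for r X
      by (simp add: f_def matrix_scalar_ac scalar_matrix_assoc scalar_mult_eq_scaleR algebra_simps)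
  qed
  moreover have "subspace S"
    by (auto simp: S_def subspace_def tr transpose_scalar) (simp add: transpose_def vec_eq_iff)
  moreover have "f ` S \<subseteq> S"
    by (auto simp: S_def f_def tr matrix_transpose_mul matrix_mul_assoc)
  \<comment> \<open>A kernel element satisfies exactly the invariance condition, so stability forces
    it to vanish.\<close>
  moreover have "H = 0" if "H \<in> S" "f H = 0" for H
    using that stable_invariant_form_eq_0[OF assms(1)] by (simp add: S_def f_def)
  ultimately have "f ` S = S"
    by (rule linear_inj_on_subspace_imp_surj_on)
  with assms(2) have "G \<in> f ` S"
    by (simp add: S_def)
  then show ?thesis
    by (auto simp: S_def f_def)
qed

end

theorem lemma3p3:
  fixes M :: "'w measure" and F :: "nat \<Rightarrow> 'w measure" and \<xi> :: "nat \<Rightarrow> 'w \<Rightarrow> real"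
    and a :: "'w \<Rightarrow> real^'n"
    and A C G :: "real^'n^'n" and b :: "real^'m^'n"
  assumes "discrete_white_noise M F \<xi>"
    and "discrete_white_noise.admissible_initial M F \<xi> a"
    and "transpose G = G"
    and "matrix_spectral_radius (cmat A) < 1"
    and "discrete_white_noise.mean_square_stable M F \<xi> A b C"
  shows "\<exists>H \<Theta> :: complex^'n^'n.
    transpose H = H \<and> transpose \<Theta> = \<Theta> \<and>
    transpose (cmat A) ** H ** cmat A - H + \<Theta> = 0 \<and>
    \<Theta> - transpose (cmat C) ** H ** cmat C - cmat G = 0"
proof -
  obtain H where H: "transpose H = H"
      "H - (transpose A ** H ** A + transpose C ** H ** C) = G"
    using discrete_white_noise.stable_lyapunov_equation_solvable[OF assms(1,5,3)] by blast
  \<comment> \<open>This choice solves the first equation by construction; substituting it turns the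
    second into the Lyapunov equation for \<open>H\<close>.\<close>
  define \<Theta> where "\<Theta> = H - transpose A ** H ** A"
  have "transpose \<Theta> = transpose H - transpose (transpose A ** H ** A)"
    by (simp add: \<Theta>_def transpose_def vec_eq_iff)
  also have "\<dots> = \<Theta>"
    using H(1) by (simp add: \<Theta>_def matrix_transpose_mul matrix_mul_assoc)
  finally have "transpose \<Theta> = \<Theta>" .
  moreover have "\<Theta> - transpose C ** H ** C - G = 0"
    using H(2) by (simp add: \<Theta>_def algebra_simps)
  \<comment> \<open>The witnesses are real matrices viewed as complex. \<open>cmat\<close> commutes
    with products, differences and the plain, unconjugated transpose, so all identities carry
    over.\<close>
  ultimately show ?thesis
    using H(1)
    by (intro exI[of _ "cmat H"] exI[of _ "cmat \<Theta>"])
      (simp add: cmat_transpose cmat_mult cmat_add cmat_diff cmat_0 \<Theta>_def)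
qed

end
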